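(* Let $\mathcal{C}_1\subseteq\mathbb{F}_{q^m}^n$ be a linear code, $\mathcal{C}_2\subsetneqq\mathcal{C}_1$ a subcode with $\dim\mathcal{C}_2=\dim\mathcal{C}_1-l$, $l\ge 1$, and $\psi:\mathbb{F}_{q^m}^l\to\mathcal{C}_1/\mathcal{C}_2$ a linear bijection, and let $\Omega$ be the universal maximum strength of the nested coset coding scheme given by $\mathcal{C}_1,\mathcal{C}_2,\psi$. Let $(S,X)$ be random variables with an arbitrary joint distribution such that $S\in\mathbb{F}_{q^m}^l$ and $X\in\psi(S)$. Then for every $0\le\mu\le n$ and every nonempty $\mathcal{Z}\subseteq\{1,\dots,l\}$, $$\max_{B\in\mathbb{F}_q^{\mu\times n}} I(S_{\mathcal{Z}};BX^{\rm T})\ \le\ [\mu-\Omega+|\mathcal{Z}|-1]^+ + D(X\|U_{\psi_{\mathcal{Z}}(S_{\mathcal{Z}})}|S_{\mathcal{Z}}).$$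
   Context: $\mathbb{F}_{q^m}$ is the degree-$m$ extension ($m\ge1$) of the finite field $\mathbb{F}_q$; linear codes are $\mathbb{F}_{q^m}$-subspaces of the row space $\mathbb{F}_{q^m}^n$, with dimensions over $\mathbb{F}_{q^m}$. $[x]^+=\max\{0,x\}$. Mutual information $I$ and relative entropy $D$ use logarithms to base $q^m$. For $\mathcal{Z}\subseteq\{1,\dots,l\}$ write $S_{\mathcal{Z}}=(S_i:i\in\mathcal{Z})$, and for $z\in\mathbb{F}_{q^m}^{|\mathcal{Z}|}$ (indexed by $\mathcal{Z}$) put $\psi_{\mathcal{Z}}(z)=\bigcup_{s\in\mathbb{F}_{q^m}^l:\ s_i=z_i\ \forall i\in\mathcal{Z}}\psi(s)\subseteq\mathcal{C}_1$. $D(X\|U_{\psi_{\mathcal{Z}}(S_{\mathcal{Z}})}|S_{\mathcal{Z}})=\sum_{z}P_{S_{\mathcal{Z}}}(z)\,D(P_{X|S_{\mathcal{Z}}=z}\,\|\,\text{uniform distribution on }\psi_{\mathcal{Z}}(z))$. The universal maximum strength $\Omega$ is a quantity of the scheme $(\mathcal{C}_1,\mathcal{C}_2,\psi)$ computed with uniform variables: let $S^\circ$ be uniform on $\mathbb{F}_{q^m}^l$ and $X^\circ$ uniform on $\psi(S^\circ)$ given $S^\circ$; then $\Omega$ is the largest integer $\omega$ such that $I(S^\circ_{\mathcal{Z}};B(X^\circ)^{\rm T})=0$ for all $\mathcal{Z}\subseteq\{1,\dots,l\}$ and all $B\in\mathbb{F}_q^{(\omega-|\mathcal{Z}|+1)\times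 n}$ (the condition being vacuous for those $\mathcal{Z}$ with $\omega-|\mathcal{Z}|+1\le0$). *)

theory Defs
  imports "HOL-Probability.Probability"
begin

definition is_subfield :: "'a::field set \<Rightarrow> bool" where
  "is_subfield K \<longleftrightarrow> 0 \<in> K \<and> 1 \<in> K \<and>
     (\<forall>x\<in>K. \<forall>y\<in>K. x - y \<in> K \<and> x * y \<in> K) \<and> (\<forall>x\<in>K. inverse x \<in> K)"


definition quotient_space :: "('a::field ^ 'n) set \<Rightarrow> ('a ^ 'n) set \<Rightarrow> ('a ^ 'n) set set" where
  "quotient_space C1 C2 = (\<lambda>c. (+) c ` C2) ` C1"

definition coset_add :: "('a::field ^ 'n) set \<Rightarrow> ('a ^ 'n) set \<Rightarrow> ('a ^ 'n) set" where
  "coset_add A B = {x + y | x y. x \<in> A \<and> y \<in> B}"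

text \<open>Adding \<open>C2\<close> matters only for \<open>a = 0\<close>, where the elementwise multiples of a coset
  give \<open>{0}\<close> instead of the zero coset \<open>C2\<close>.\<close>

definition coset_scale :: "('a::field ^ 'n) set \<Rightarrow> 'a \<Rightarrow> ('a ^ 'n) set \<Rightarrow> ('a ^ 'n) set" where
  "coset_scale C2 a A = {a *s x + y | x y. x \<in> A \<and> y \<in> C2}"

definition linear_bij_to_quotient ::
  "('a::field ^ 'l \<Rightarrow> ('a ^ 'n) set) \<Rightarrow> ('a ^ 'n) set \<Rightarrow> ('a ^ 'n) set \<Rightarrow> bool" where
  "linear_bij_to_quotient \<psi> C1 C2 \<longleftrightarrow>
     bij_betw \<psi> UNIV (quotient_space C1 C2) \<and>
     (\<forall>s t. \<psi> (s + t) = coset_add (\<psi> s) (\<psi> t)) \<and>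
     (\<forall>a s. \<psi> (a *s s) = coset_scale C2 a (\<psi> s))"


text \<open>The number of rows of a matrix ranges over all naturals inside a statement, so a
  \<open>k \<times> n\<close> matrix is the extensional family of its \<open>k\<close> rows, and its product with a column
  is an extensional family of \<open>k\<close> scalars.\<close>

definition matrices_over :: "'a set \<Rightarrow> nat \<Rightarrow> (nat \<Rightarrow> 'a::field ^ 'n) set" where
  "matrices_over K k = {..<k} \<rightarrow>\<^sub>E {r. \<forall>j. r $ j \<in> K}"

definition mat_vec :: "nat \<Rightarrow> (nat \<Rightarrow> 'a::field ^ 'n) \<Rightarrow> 'a ^ 'n \<Rightarrow> nat \<Rightarrow> 'a" where
  "mat_vec k B x = (\<lambda>i\<in>{..<k}. \<Sum>j\<in>UNIV. B i $ j * x $ j)"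


definition subvec :: "'l set \<Rightarrow> 'a ^ 'l \<Rightarrow> 'l \<Rightarrow> 'a" where
  "subvec Z s = restrict (\<lambda>i. s $ i) Z"

definition psi_sub :: "('a ^ 'l \<Rightarrow> ('a ^ 'n) set) \<Rightarrow> 'l set \<Rightarrow> ('l \<Rightarrow> 'a) \<Rightarrow> ('a ^ 'n) set" where
  "psi_sub \<psi> Z z = (\<Union>s\<in>{s. \<forall>i\<in>Z. s $ i = z i}. \<psi> s)"


text \<open>This is the library's mutual information of two random variables of
  finite range, each with the discrete measurable space on its range.\<close>

abbreviation mutual_info :: "real \<Rightarrow> 'w measure \<Rightarrow> ('w \<Rightarrow> 'b) \<Rightarrow> ('w \<Rightarrow> 'c) \<Rightarrow> real" where
  "mutual_info b M X Y \<equiv> information_space.mutual_information_Pow M b X Y"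

text \<open>Note the argument order of the library: \<open>KL_divergence b N P\<close> is \<open>D(P \<parallel> N)\<close>.
  Values \<open>z\<close> of probability zero contribute zero.\<close>

definition cond_divergence_uniform ::
  "real \<Rightarrow> ('a::finite ^ 'l \<Rightarrow> ('a ^ 'n) set) \<Rightarrow> 'l set \<Rightarrow>
   'w measure \<Rightarrow> ('w \<Rightarrow> 'a ^ 'l) \<Rightarrow> ('w \<Rightarrow> 'a ^ 'n) \<Rightarrow> real" where
  "cond_divergence_uniform b \<psi> Z M S X =
     (\<Sum>z\<in>Z \<rightarrow>\<^sub>E UNIV.
        measure M {w \<in> space M. subvec Z (S w) = z} *
        KL_divergence b
          (uniform_measure (count_space UNIV) (psi_sub \<psi> Z z))
          (distr (uniform_measure M {w \<in> space M. subvec Z (S w) = z}) (count_space UNIV) X))"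


definition uniform_scheme :: "('a::finite ^ 'l \<Rightarrow> ('a ^ 'n) set) \<Rightarrow> (('a ^ 'l) \<times> ('a ^ 'n)) pmf" where
  "uniform_scheme \<psi> =
     bind_pmf (pmf_of_set UNIV) (\<lambda>s. map_pmf (Pair s) (pmf_of_set (\<psi> s)))"

definition has_universal_strength ::
  "real \<Rightarrow> 'a set \<Rightarrow> ('a::{field,finite} ^ 'l \<Rightarrow> ('a ^ 'n) set) \<Rightarrow> int \<Rightarrow> bool" where
  "has_universal_strength b K \<psi> \<omega> \<longleftrightarrow>
     (\<forall>(Z :: 'l set) (k :: nat).
        int k = \<omega> - int (card Z) + 1 \<and> 0 < k \<longrightarrow>
        (\<forall>B\<in>matrices_over K k.
           mutual_info b (measure_pmf (uniform_scheme \<psi>))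
             (\<lambda>(s, x). subvec Z s) (\<lambda>(s, x). mat_vec k B x) = 0))"

definition universal_max_strength ::
  "real \<Rightarrow> 'a set \<Rightarrow> ('a::{field,finite} ^ 'l \<Rightarrow> ('a ^ 'n) set) \<Rightarrow> int" where
  "universal_max_strength b K \<psi> = (GREATEST \<omega>. has_universal_strength b K \<psi> \<omega>)"

end

theory Submission
  imports Defs
begin

text \<open>Write \<open>A\<close> for \<open>\<psi>\<^sub>Z(0)\<close>, a subgroup whose cosets are the sets \<open>\<psi>\<^sub>Z(z)\<close>, and \<open>N\<close> for the size
  of the large field. Expanding \<open>I(S\<^sub>Z; BX) - D\<close> as one finite sum over the values \<open>(z, x)\<close> and
  applying Gibbs' inequality bounds it by \<open>log (|B C\<^sub>1| / |B A|)\<close>, because every fibre of \<open>B\<close> in a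
  coset of \<open>A\<close> has at most \<open>|A| / |B A|\<close> elements. Now let \<open>k = \<Omega> - |Z| + 1\<close>. Vanishing mutual
  information makes \<open>S\<^sub>Z = 0\<close> jointly possible with every possible value of the first \<open>k\<close> rows of
  \<open>BX\<close>, so these rows take the same values on \<open>A\<close> as on \<open>C\<^sub>1\<close>; each remaining row contributes at
  most a factor \<open>N\<close>, whence \<open>|B C\<^sub>1| \<le> |B A| N\<^bsup>\<mu>-k\<^esup>\<close>.\<close>

section \<open>Gibbs' inequality and relative entropy to a uniform distribution\<close>

text \<open>The termwise bound \<open>ln u \<le> u - 1\<close> at
  \<open>u = t i / (p i * c)\<close>, weighted by \<open>p i\<close>, leaves the mass of
  \<open>t\<close> divided by \<open>c\<close>, minus 1, which is at most 0. The mass of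
  \<open>t\<close> is bounded only over the support of \<open>p\<close>, since that is what both
  later uses can control.\<close>

lemma gibbs_inequality:
  fixes p t :: "'i \<Rightarrow> real"
  assumes b: "1 < b" and fin: "finite I"
    and p: "\<And>i. i \<in> I \<Longrightarrow> 0 \<le> p i" and p1: "sum p I = 1"
    and t: "\<And>i. i \<in> I \<Longrightarrow> p i \<noteq> 0 \<Longrightarrow> 0 < t i"
    and c: "(\<Sum>i | i \<in> I \<and> p i \<noteq> 0. t i) \<le> c"
  shows "(\<Sum>i\<in>I. p i * log b (t i / p i)) \<le> log b c"
proof -
  let ?J = "{i \<in> I. p i \<noteq> 0}"
  have finJ: "finite ?J" using fin by simp
  have pJ: "sum p ?J = 1"
    unfolding p1[symmetric] using fin by (intro sum.mono_neutral_left) auto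
  \<comment> \<open>Positivity of \<open>c\<close> comes from the nonempty support of
    \<open>p\<close>, on which \<open>t\<close> is positive.\<close>
  then have "?J \<noteq> {}" by (metis sum.empty zero_neq_one)
  then have "0 < (\<Sum>i\<in>?J. t i)" using t finJ by (intro sum_pos) auto
  with c have c0: "0 < c" by linarith
  have "(\<Sum>i\<in>I. p i * log b (t i / p i)) - log b c = (\<Sum>i\<in>?J. p i * log b (t i / p i)) - (\<Sum>i\<in>?J. p i * log b c)"
    using fin by (subst sum.mono_neutral_cong_right[of I ?J])
      (auto simp: pJ sum_distrib_right[symmetric])
  also have "\<dots> = (\<Sum>i\<in>?J. p i * (log b (t i / p i) - log b c))"
    by (simp add: sum_subtractf[symmetric] right_diff_distrib)
  also have "\<dots> \<le> (\<Sum>i\<in>?J. (t i / c - p i) / ln b)"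
  proof (rule sum_mono)
    fix i assume i: "i \<in> ?J"
    then have pos: "0 < p i" "0 < t i" using p[of i] t[of i] by auto
    have "0 < ln b" using b by simp
    then have "p i * (log b (t i / p i) - log b c) = p i * ln (t i / p i / c) / ln b"
      using pos c0 by (simp add: log_def ln_div ln_mult field_simps)
    also have "\<dots> \<le> p i * (t i / p i / c - 1) / ln b"
      using pos c0 b by (intro divide_right_mono mult_left_mono ln_le_minus_one) auto
    also have "\<dots> = (t i / c - p i) / ln b"
      using pos by (simp add: field_simps)
    finally show "p i * (log b (t i / p i) - log b c) \<le> (t i / c - p i) / ln b" .
  qed
  also have "\<dots> = ((\<Sum>i\<in>?J. t i) / c - 1) / ln b"
    by (simp only: sum_divide_distrib[symmetric] sum_subtractf pJ)
  also have "\<dots> \<le> 0"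
    using c c0 b by (intro divide_nonpos_pos) auto
  finally show ?thesis by simp
qed

text \<open>Both measures have densities with respect to counting measure, the uniform one being
  \<open>1 / card A\<close> on \<open>A\<close>. The assumption \<open>supp\<close> is the absolute
  continuity that the density formula asks for.\<close>

lemma KL_divergence_uniform_finite:
  fixes N :: "'x::finite measure"
  assumes b: "1 < b" and N: "prob_space N" and sets: "sets N = UNIV"
    and A: "A \<noteq> {}" and supp: "\<And>x. x \<notin> A \<Longrightarrow> measure N {x} = 0"
  shows "KL_divergence b (uniform_measure (count_space UNIV) A) N
    = (\<Sum>x\<in>UNIV. measure N {x} * log b (measure N {x} * card A))"
proof -
  interpret N: prob_space N by fact
  interpret count: sigma_finite_measure "count_space (UNIV :: 'x set)"
    by (rule sigma_finite_measure_count_space_finite) simp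
  have card: "0 < card A" using A by (simp add: card_gt_0_iff)
  have dens: "N = density (count_space UNIV) (\<lambda>x. ennreal (measure N {x}))"
    by (rule measure_eqI_finite[of _ UNIV])
      (auto simp: sets emeasure_density nn_integral_count_space_finite N.emeasure_eq_measure
        indicator_def if_distrib[of "\<lambda>c. _ * c"] cong: if_cong)
  have unif: "uniform_measure (count_space UNIV) A
    = density (count_space UNIV) (\<lambda>x. ennreal (indicator A x / card A))"
    unfolding uniform_measure_def
    by (rule density_cong)
      (use card in \<open>auto simp: indicator_def ennreal_of_nat_eq_real_of_nat divide_ennreal[symmetric]\<close>)
  have "KL_divergence b (uniform_measure (count_space UNIV) A) N
    = (\<integral>x. measure N {x} * log b (measure N {x} / (indicator A x / card A)) \<partial>count_space UNIV)"
    unfolding unif by (subst dens, rule count.KL_density_density[OF b])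
      (use card supp in \<open>auto simp: AE_count_space indicator_def split: if_splits\<close>)
  also have "\<dots> = (\<Sum>x\<in>UNIV. measure N {x} * log b (measure N {x} / (indicator A x / card A)))"
    by (simp add: lebesgue_integral_count_space_finite)
  also have "\<dots> = (\<Sum>x\<in>UNIV. measure N {x} * log b (measure N {x} * card A))"
  proof (rule sum.cong[OF refl])
    fix x
    \<comment> \<open>Outside \<open>A\<close> the quotient divides by 0, but there
      \<open>supp\<close> makes the factor in front vanish.\<close>
    show "measure N {x} * log b (measure N {x} / (indicator A x / card A))
      = measure N {x} * log b (measure N {x} * card A)"
      by (cases "x \<in> A") (auto simp: supp)
  qed
  finally show ?thesis .
qed

section \<open>Finite-valued random variables and total probability\<close>

context prob_space
begin

lemma measurable_count_space_eq:
  assumes "finite I" "U \<in> measurable M (count_space I)"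
  shows "{w \<in> space M. U w = z} \<in> events"
proof (cases "z \<in> I")
  case True
  then have "U -` {z} \<inter> space M \<in> events"
    using assms by (simp add: measurable_count_space_eq2)
  also have "U -` {z} \<inter> space M = {w \<in> space M. U w = z}" by auto
  finally show ?thesis .
next
  case False
  then have "{w \<in> space M. U w = z} = {}"
    using measurable_space[OF assms(2)] by auto
  then show ?thesis by (simp only: sets.empty_sets)
qed

text \<open>The predicate \<open>Q\<close> is arbitrary so that one law covers both normalisation
  (\<open>Q\<close> constantly true) and passing from joint to marginal probabilities.\<close>

lemma prob_sum_values:
  assumes "finite I" "U \<in> measurable M (count_space I)" "Measurable.pred M Q"
  shows "\<P>(w in M. Q w) = (\<Sum>z\<in>I. \<P>(w in M. U w = z \<and> Q w))"
proof -
  have "\<P>(w in M. Q w) = prob (\<Union>z\<in>I. {w\<in>space M. U w = z \<and> Q w})"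
    using measurable_space[OF assms(2)] by (intro arg_cong[where f=prob]) auto
  also have "\<dots> = (\<Sum>z\<in>I. \<P>(w in M. U w = z \<and> Q w))"
  proof (rule finite_measure_finite_Union)
    show "(\<lambda>z. {w \<in> space M. U w = z \<and> Q w}) ` I \<subseteq> events"
    proof (intro image_subsetI)
      fix z
      have "{w \<in> space M. U w = z \<and> Q w} = {w \<in> space M. U w = z} \<inter> {w \<in> space M. Q w}"
        by auto
      also have "\<dots> \<in> events"
        using measurable_count_space_eq[OF assms(1,2)] assms(3) by (intro sets.Int) (auto simp: pred_def)
      finally show "{w \<in> space M. U w = z \<and> Q w} \<in> events" .
    qed
  qed (use assms(1) in \<open>auto simp: disjoint_family_on_def\<close>)
  finally show ?thesis .
qed

end

section \<open>Mutual information of finite-valued variables\<close>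

context information_space
begin

text \<open>The formula for simple distributions sums over the attained pairs. Pairs never attained
  have joint probability 0 and add nothing, so the sum extends to a full rectangle, over which
  summations can be exchanged and regrouped.\<close>

lemma mutual_information_finite_sum:
  assumes I: "finite I" "U \<in> measurable M (count_space I)"
    and J: "finite J" "V \<in> measurable M (count_space J)"
  shows "\<I>(U ; V) = (\<Sum>(z, y)\<in>I \<times> J. \<P>(w in M. U w = z \<and> V w = y)
    * log b (\<P>(w in M. U w = z \<and> V w = y) / (\<P>(w in M. U w = z) * \<P>(w in M. V w = y))))"
proof -
  have sf: "simple_function M U" if "finite I" "U \<in> measurable M (count_space I)" for I and U :: "'a \<Rightarrow> 'k"
  proof -
    have "finite (U ` space M)"
      using measurable_space[OF that(2)] by (intro finite_subset[OF _ that(1)]) auto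
    moreover have "U -` {z} \<inter> space M \<in> events" for z
    proof -
      have "{w \<in> space M. U w = z} = U -` {z} \<inter> space M" by auto
      then show ?thesis using measurable_count_space_eq[OF that, of z] by (simp only:)
    qed
    ultimately show ?thesis by (simp add: simple_function_def)
  qed
  note UV = sf[OF I] sf[OF J]
  have "simple_function M (\<lambda>w. (U w, V w))"
    using UV by (rule simple_function_Pair)
  then have UV': "simple_distributed M (\<lambda>w. (U w, V w)) (\<lambda>(z, y). \<P>(w in M. U w = z \<and> V w = y))"
  proof (rule simple_distributedI)
    fix i show "(case i of (z, y) \<Rightarrow> \<P>(w in M. U w = z \<and> V w = y))
      = prob ((\<lambda>w. (U w, V w)) -` {i} \<inter> space M)"
      by (cases i) (auto intro: arg_cong[where f=prob])
  qed (auto simp: split_beta)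
  have U': "simple_distributed M U (\<lambda>z. \<P>(w in M. U w = z))"
    by (rule simple_distributedI[OF UV(1)]) (auto intro: arg_cong[where f=prob])
  have V': "simple_distributed M V (\<lambda>y. \<P>(w in M. V w = y))"
    by (rule simple_distributedI[OF UV(2)]) (auto intro: arg_cong[where f=prob])
  have "\<I>(U ; V) = (\<Sum>(z, y)\<in>(\<lambda>w. (U w, V w)) ` space M. \<P>(w in M. U w = z \<and> V w = y)
    * log b (\<P>(w in M. U w = z \<and> V w = y) / (\<P>(w in M. U w = z) * \<P>(w in M. V w = y))))"
    unfolding mutual_information_simple_distributed[OF U' V' UV'] by (intro sum.cong) auto
  also have "\<dots> = (\<Sum>(z, y)\<in>I \<times> J. \<P>(w in M. U w = z \<and> V w = y)
    * log b (\<P>(w in M. U w = z \<and> V w = y) / (\<P>(w in M. U w = z) * \<P>(w in M. V w = y))))"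
  proof (rule sum.mono_neutral_left)
    show "(\<lambda>w. (U w, V w)) ` space M \<subseteq> I \<times> J"
      using measurable_space[OF I(2)] measurable_space[OF J(2)] by auto
    show "\<forall>i\<in>I \<times> J - (\<lambda>w. (U w, V w)) ` space M. (case i of (z, y) \<Rightarrow>
        \<P>(w in M. U w = z \<and> V w = y) * log b (\<P>(w in M. U w = z \<and> V w = y) /
          (\<P>(w in M. U w = z) * \<P>(w in M. V w = y)))) = 0"
    proof
      fix i assume i: "i \<in> I \<times> J - (\<lambda>w. (U w, V w)) ` space M"
      then have "{w \<in> space M. U w = fst i \<and> V w = snd i} = {}" by auto
      then have "\<P>(w in M. U w = fst i \<and> V w = snd i) = 0" by (simp only: measure_empty)
      then show "(case i of (z, y) \<Rightarrow>
        \<P>(w in M. U w = z \<and> V w = y) * log b (\<P>(w in M. U w = z \<and> V w = y) /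
          (\<P>(w in M. U w = z) * \<P>(w in M. V w = y)))) = 0"
        by (simp only: split_beta mult_zero_left)
    qed
  qed (use I J in auto)
  finally show ?thesis .
qed

lemma prob_pair_pos_if_mutual_information_eq_0:
  assumes I: "finite I" "U \<in> measurable M (count_space I)"
    and J: "finite J" "V \<in> measurable M (count_space J)"
    and "\<I>(U ; V) = 0"
    and pos: "0 < \<P>(w in M. U w = z)" "0 < \<P>(w in M. V w = y)"
  shows "0 < \<P>(w in M. U w = z \<and> V w = y)"
proof (rule ccontr)
  let ?r = "\<lambda>(z, y). \<P>(w in M. U w = z \<and> V w = y)"
  \<comment> \<open>If the pair had probability 0, the product law would give the support of the joint law mass
    at most \<open>?c < 1\<close>, and Gibbs' inequality would make the mutual information positive.\<close>
  let ?t = "\<lambda>(z, y). \<P>(w in M. U w = z) * \<P>(w in M. V w = y)"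
  let ?K = "I \<times> J" and ?L = "{i \<in> I \<times> J. ?r i \<noteq> 0}" and ?c = "1 - ?t (z, y)"
  assume "\<not> ?thesis"
  then have r0: "?r (z, y) = 0" by (simp add: zero_less_measure_iff)
  have [measurable]: "Measurable.pred M (\<lambda>w. U w = z)" "Measurable.pred M (\<lambda>w. V w = y)" for z y
    using measurable_count_space_eq[OF I] measurable_count_space_eq[OF J] by (auto simp: pred_def)
  have "{w \<in> space M. U w = z} \<noteq> {}" "{w \<in> space M. V w = y} \<noteq> {}"
    using pos by (metis less_irrefl measure_empty)+
  then have "z \<in> I" "y \<in> J"
    using measurable_space[OF I(2)] measurable_space[OF J(2)] by auto
  then have zy: "(z, y) \<in> ?K - ?L" using r0 by simp
  have sumV: "(\<Sum>y\<in>J. \<P>(w in M. V w = y)) = 1"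
    using prob_sum_values[OF J, of "\<lambda>_. True"] by (simp add: prob_space)
  have sumU: "(\<Sum>z\<in>I. \<P>(w in M. U w = z)) = 1"
    using prob_sum_values[OF I, of "\<lambda>_. True"] by (simp add: prob_space)
  have t1: "sum ?t ?K = 1"
    by (simp add: sum.cartesian_product[symmetric] sum_distrib_left[symmetric] sumU sumV)
  have r1: "sum ?r ?K = 1"
  proof -
    have "sum ?r ?K = (\<Sum>y\<in>J. \<Sum>z\<in>I. \<P>(w in M. U w = z \<and> V w = y))"
      by (subst sum.swap) (simp add: sum.cartesian_product)
    also have "\<dots> = (\<Sum>y\<in>J. \<P>(w in M. V w = y))"
      by (intro sum.cong refl prob_sum_values[OF I, symmetric]) measurable
    finally show ?thesis by (simp add: sumV)
  qed
  \<comment> \<open>Each marginal dominates the joint probability, so positivity passes to the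
    product.\<close>
  have tpos: "0 < ?t i" if "i \<in> ?K" "?r i \<noteq> 0" for i
  proof -
    have "?r i \<le> \<P>(w in M. U w = fst i)" "?r i \<le> \<P>(w in M. V w = snd i)"
      by (cases i; auto intro!: finite_measure_mono measurable_count_space_eq I J)+
    moreover have "0 < ?r i" using that by (cases i) (auto simp: zero_less_measure_iff)
    ultimately show ?thesis by (cases i) auto
  qed
  have "sum ?t ?L + ?t (z, y) = sum ?t (insert (z, y) ?L)"
    using I J zy by (subst sum.insert) auto
  also have "\<dots> \<le> sum ?t ?K"
    using I J zy by (intro sum_mono2) auto
  finally have c: "sum ?t ?L \<le> ?c" using t1 by simp
  have "(\<Sum>i\<in>?K. ?r i * log b (?t i / ?r i)) \<le> log b ?c"
    by (rule gibbs_inequality[OF b_gt_1 _ _ r1 tpos c]) (use I J in auto)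
  moreover have "(\<Sum>i\<in>?K. ?r i * log b (?t i / ?r i)) = - \<I>(U ; V)"
    unfolding mutual_information_finite_sum[OF I J] sum_negf[symmetric]
  proof (rule sum.cong[OF refl])
    fix i assume "i \<in> ?K"
    show "?r i * log b (?t i / ?r i) = - (case i of (z, y) \<Rightarrow> \<P>(w in M. U w = z \<and> V w = y)
      * log b (\<P>(w in M. U w = z \<and> V w = y) / (\<P>(w in M. U w = z) * \<P>(w in M. V w = y))))"
    proof (cases "?r i = 0")
      case False
      moreover have "0 < ?r i" using False by (cases i) (auto simp: zero_less_measure_iff)
      ultimately show ?thesis using tpos[OF \<open>i \<in> ?K\<close>]
        by (cases i) (simp add: log_divide algebra_simps)
    qed (cases i, simp)
  qed
  ultimately have "0 \<le> log b ?c" using assms(5) by simp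
  \<comment> \<open>Only for positive \<open>?c\<close> does \<open>0 \<le> log b ?c\<close> force
    \<open>1 \<le> ?c\<close>. The joint law has nonempty support, where the product law is
    positive, and that mass is at most \<open>?c\<close>.\<close>
  moreover have "0 < ?c"
  proof -
    have "?L \<noteq> {}"
    proof
      assume "?L = {}"
      then have "\<And>i. i \<in> ?K \<Longrightarrow> ?r i = 0" by blast
      then have "sum ?r ?K = 0" by (intro sum.neutral) blast
      then show False using r1 by simp
    qed
    then have "0 < sum ?t ?L"
      using I J tpos by (intro sum_pos) auto
    then show ?thesis using c by linarith
  qed
  moreover have "?c < 1" using pos by simp
  ultimately show False using b_gt_1 zero_le_log_cancel_iff[of b ?c] by linarith
qed

text \<open>In the application the sets \<open>A z\<close> are cosets of one group, \<open>n\<close>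
  is their size and \<open>k\<close> the size of the image of the group under \<open>g\<close>. The
  double sum on the right is then the conditional divergence, and moving it to the left turns the
  claim into Gibbs' inequality.\<close>

lemma mutual_information_function_le:
  fixes X :: "'a \<Rightarrow> 'x::finite" and g :: "'x \<Rightarrow> 'y" and A :: "'u \<Rightarrow> 'x set"
  assumes I: "finite I" "U \<in> measurable M (count_space I)"
    and X: "X \<in> measurable M (count_space UNIV)"
    and ae: "AE w in M. X w \<in> A (U w)"
    and n: "0 < n" and k: "0 < k"
    and fiber: "\<And>z y. z \<in> I \<Longrightarrow> card {x \<in> A z. g x = y} * k \<le> n"
    and W: "finite W" "\<And>z x. z \<in> I \<Longrightarrow> x \<in> A z \<Longrightarrow> g x \<in> W"
  shows "\<I>(U ; \<lambda>w. g (X w)) \<le> log b (card W / k)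
    + (\<Sum>z\<in>I. \<Sum>x\<in>UNIV. \<P>(w in M. U w = z \<and> X w = x)
        * log b (\<P>(w in M. U w = z \<and> X w = x) / \<P>(w in M. U w = z) * n))"
proof -
  let ?V = "\<lambda>w. g (X w)"
  let ?p = "\<lambda>(z, x). \<P>(w in M. U w = z \<and> X w = x)"
  let ?P = "\<lambda>z. \<P>(w in M. U w = z)" and ?Q = "\<lambda>y. \<P>(w in M. ?V w = y)"
  let ?r = "\<lambda>z y. \<P>(w in M. U w = z \<and> ?V w = y)"
  \<comment> \<open>Chosen so that \<open>?t i / ?p i\<close> is the logarithm's argument in the
    information divided by its argument in the divergence; the marginal \<open>?P z\<close>
    cancels.\<close>
  let ?t = "\<lambda>(z, x). ?r z (g x) / (?Q (g x) * n)"
  let ?J = "range g" and ?K = "I \<times> (UNIV :: 'x set)"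
  let ?L = "{i \<in> ?K. ?p i \<noteq> 0}"
  have J: "finite ?J" "?V \<in> measurable M (count_space ?J)"
    using measurable_compose[OF X, of g "count_space ?J"] by auto
  have X': "finite (UNIV :: 'x set)" by simp
  have [measurable]: "Measurable.pred M (\<lambda>w. U w = z)" "Measurable.pred M (\<lambda>w. X w = x)"
      "Measurable.pred M (\<lambda>w. ?V w = y)" for z x y
    using measurable_count_space_eq[OF I] measurable_count_space_eq[OF X' X]
      measurable_count_space_eq[OF J] by (auto simp: pred_def)
  have p1: "sum ?p ?K = 1"
  proof -
    have "sum ?p ?K = (\<Sum>x\<in>UNIV. \<Sum>z\<in>I. \<P>(w in M. U w = z \<and> X w = x))"
      by (subst sum.swap) (simp add: sum.cartesian_product)
    also have "\<dots> = (\<Sum>x\<in>UNIV. \<P>(w in M. X w = x))"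
      by (intro sum.cong refl prob_sum_values[OF I, symmetric]) measurable
    finally show ?thesis
      using prob_sum_values[OF X' X, of "\<lambda>_. True"] by (simp add: prob_space)
  qed
  have supp: "x \<in> A z" if "?p (z, x) \<noteq> 0" for z x
  proof (rule ccontr)
    assume "x \<notin> A z"
    then have "AE w in M. \<not> (U w = z \<and> X w = x)"
      by (intro eventually_mono[OF ae]) auto
    then have "?p (z, x) = 0" by (simp add: prob_Collect_eq_0)
    then show False using that by simp
  qed
  have ple: "?p (z, x) \<le> ?P z" "?p (z, x) \<le> ?r z (g x)" "?r z (g x) \<le> ?Q (g x)" for z x
    by (auto intro!: finite_measure_mono)
  have ppos: "0 < ?p (z, x)" if "?p (z, x) \<noteq> 0" for z x
    using that by (auto simp: zero_less_measure_iff)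
  have tpos: "0 < ?t i" if "i \<in> ?K" "?p i \<noteq> 0" for i
    using that ppos[of "fst i" "snd i"] ple[of "fst i" "snd i"] n
    by (cases i) (auto intro!: divide_pos_pos mult_pos_pos)
  have rsum: "?r z y = (\<Sum>x | g x = y. ?p (z, x))" for z y
  proof -
    have "?r z y = (\<Sum>x\<in>UNIV. \<P>(w in M. X w = x \<and> U w = z \<and> ?V w = y))"
      by (rule prob_sum_values[OF X' X]) measurable
    also have "\<dots> = (\<Sum>x\<in>UNIV. if g x = y then ?p (z, x) else 0)"
    proof (rule sum.cong[OF refl])
      fix x
      have "{w \<in> space M. X w = x \<and> U w = z \<and> ?V w = y}
        = (if g x = y then {w \<in> space M. U w = z \<and> X w = x} else {})" by auto
      then show "\<P>(w in M. X w = x \<and> U w = z \<and> ?V w = y) = (if g x = y then ?p (z, x) else 0)"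
        by simp
    qed
    finally show ?thesis by (simp add: sum.If_cases)
  qed
  \<comment> \<open>Splitting \<open>?r z y\<close> over the fibre of \<open>y\<close> gives the
    information the same index set as the divergence.\<close>
  have info: "\<I>(U ; ?V) = (\<Sum>z\<in>I. \<Sum>x\<in>UNIV. ?p (z, x) * log b (?r z (g x) / (?P z * ?Q (g x))))"
  proof -
    have "\<I>(U ; ?V) = (\<Sum>z\<in>I. \<Sum>y\<in>?J. ?r z y * log b (?r z y / (?P z * ?Q y)))"
      by (simp only: mutual_information_finite_sum[OF I J] sum.cartesian_product)
    also have "\<dots> = (\<Sum>z\<in>I. \<Sum>y\<in>?J. \<Sum>x | x \<in> UNIV \<and> g x = y. ?p (z, x) * log b (?r z (g x) / (?P z * ?Q (g x))))"
      by (intro sum.cong refl) (subst rsum, simp add: sum_distrib_right)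
    also have "\<dots> = (\<Sum>z\<in>I. \<Sum>x\<in>UNIV. ?p (z, x) * log b (?r z (g x) / (?P z * ?Q (g x))))"
      by (intro sum.cong refl sum.group) auto
    finally show ?thesis .
  qed
  have bound: "sum ?t ?L \<le> card W / k"
  proof -
    have "sum ?t ?L = (\<Sum>z\<in>I. \<Sum>x | ?p (z, x) \<noteq> 0. ?t (z, x))"
    proof -
      have "?L = Sigma I (\<lambda>z. {x. ?p (z, x) \<noteq> 0})" by auto
      then show ?thesis using I by (simp add: sum.Sigma)
    qed
    \<comment> \<open>On the support \<open>x\<close> lies in \<open>A z\<close>, hence
      \<open>g x\<close> in \<open>W\<close>, so grouping by values in \<open>W\<close> loses no
      term.\<close>
    also have "\<dots> = (\<Sum>z\<in>I. \<Sum>y\<in>W. \<Sum>x | x \<in> {x. ?p (z, x) \<noteq> 0} \<and> g x = y. ?t (z, x))"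
      using W supp by (intro sum.cong refl sum.group[symmetric]) auto
    also have "\<dots> \<le> (\<Sum>z\<in>I. \<Sum>y\<in>W. ?r z y / ?Q y / k)"
    proof (intro sum_mono)
      fix z y assume z: "z \<in> I"
      let ?F = "{x. x \<in> {x. ?p (z, x) \<noteq> 0} \<and> g x = y}"
      have "card ?F * k \<le> card {x \<in> A z. g x = y} * k"
        using supp by (intro mult_right_mono card_mono) auto
      also have "\<dots> \<le> n" by (rule fiber[OF z])
      finally have "real (card ?F * k) \<le> real n" by (simp only: of_nat_le_iff)
      then have F: "real (card ?F) / n \<le> 1 / k"
        using n k by (simp add: pos_divide_le_eq pos_le_divide_eq del: mem_Collect_eq)
      \<comment> \<open>\<open>?t (z, x)\<close> depends on \<open>x\<close> only through
        \<open>g x\<close>, so it is constant on the fibre.\<close>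
      have "(\<Sum>x\<in>?F. ?t (z, x)) = (\<Sum>x\<in>?F. ?r z y / (?Q y * n))"
        by (intro sum.cong refl) auto
      also have "\<dots> = ?r z y / ?Q y * (card ?F / n)" by (simp only: sum_constant) simp
      also have "\<dots> \<le> ?r z y / ?Q y * (1 / k)"
        by (intro mult_left_mono F) simp
      finally show "(\<Sum>x\<in>?F. ?t (z, x)) \<le> ?r z y / ?Q y / k" by simp
    qed
    also have "\<dots> = (\<Sum>y\<in>W. (\<Sum>z\<in>I. ?r z y) / ?Q y / k)"
      by (subst sum.swap) (simp add: sum_divide_distrib)
    also have "\<dots> = (\<Sum>y\<in>W. ?Q y / ?Q y / k)"
      by (intro sum.cong refl arg_cong2[where f="(/)"] prob_sum_values[OF I, symmetric]) measurable
    \<comment> \<open>Only an inequality, because \<open>?Q y / ?Q y\<close> is 0 at values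
      \<open>y\<close> of probability 0.\<close>
    also have "\<dots> \<le> (\<Sum>y\<in>W. 1 / k)"
      by (intro sum_mono divide_right_mono) (auto simp: divide_self_if)
    finally show ?thesis by simp
  qed
  have "(\<Sum>i\<in>?K. ?p i * log b (?t i / ?p i)) \<le> log b (card W / k)"
    by (rule gibbs_inequality[OF b_gt_1 _ _ p1 tpos bound]) (use I in auto)
  moreover have "(\<Sum>i\<in>?K. ?p i * log b (?t i / ?p i)) = \<I>(U ; ?V)
      - (\<Sum>z\<in>I. \<Sum>x\<in>UNIV. ?p (z, x) * log b (?p (z, x) / ?P z * n))"
  proof -
    have "?p (z, x) * log b (?t (z, x) / ?p (z, x)) =
      ?p (z, x) * log b (?r z (g x) / (?P z * ?Q (g x))) - ?p (z, x) * log b (?p (z, x) / ?P z * n)" for z x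
    proof (cases "?p (z, x) = 0")
      case False
      have pos: "0 < ?p (z, x)" using ppos[OF False] .
      then have pos': "0 < ?P z" "0 < ?r z (g x)" "0 < ?Q (g x)"
        using ple[of z x] by linarith+
      have "?t (z, x) / ?p (z, x) = ?r z (g x) / (?P z * ?Q (g x)) / (?p (z, x) / ?P z * n)"
        using pos pos' n by (simp add: field_simps)
      moreover have "log b (?r z (g x) / (?P z * ?Q (g x)) / (?p (z, x) / ?P z * n))
         = log b (?r z (g x) / (?P z * ?Q (g x))) - log b (?p (z, x) / ?P z * n)"
        using pos pos' n by (intro log_divide_pos divide_pos_pos mult_pos_pos) auto
      ultimately show ?thesis by (simp only: right_diff_distrib)
    qed simp
    then have "(\<Sum>z\<in>I. \<Sum>x\<in>UNIV. ?p (z, x) * log b (?t (z, x) / ?p (z, x)))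
      = (\<Sum>z\<in>I. \<Sum>x\<in>UNIV. ?p (z, x) * log b (?r z (g x) / (?P z * ?Q (g x)))
          - ?p (z, x) * log b (?p (z, x) / ?P z * n))"
      by (intro sum.cong refl)
    then show ?thesis
      unfolding info by (simp only: sum_subtractf sum.Sigma[OF I(1)] sum.cartesian_product cond_case_prod_eta)
  qed
  ultimately show ?thesis by simp
qed

end

section \<open>The conditional divergence as a finite sum\<close>

text \<open>Conditioning on \<open>z\<close> divides the joint masses by the probability of
  \<open>z\<close>, and the weight in front of the divergence multiplies it back. The common size
  \<open>n\<close> of the sets lets the result match the sum in
  \<open>mutual_information_function_le\<close>.\<close>

lemma cond_divergence_uniform_eq:
  fixes \<psi> :: "'a::finite ^ 'l \<Rightarrow> ('a ^ 'n) set"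
  assumes M: "prob_space M" and b: "1 < b"
    and S: "S \<in> measurable M (count_space UNIV)" and X: "X \<in> measurable M (count_space UNIV)"
    and ae: "AE w in M. X w \<in> psi_sub \<psi> Z (subvec Z (S w))"
    and card: "\<And>z. card (psi_sub \<psi> Z z) = n" and n: "0 < n"
  shows "cond_divergence_uniform b \<psi> Z M S X =
    (\<Sum>z\<in>Z \<rightarrow>\<^sub>E UNIV. \<Sum>x\<in>UNIV. measure M {w \<in> space M. subvec Z (S w) = z \<and> X w = x}
      * log b (measure M {w \<in> space M. subvec Z (S w) = z \<and> X w = x}
          / measure M {w \<in> space M. subvec Z (S w) = z} * n))"
  unfolding cond_divergence_uniform_def
proof (rule sum.cong[OF refl])
  interpret M: prob_space M by fact
  note X[measurable]
  fix z
  let ?U = "\<lambda>w. subvec Z (S w)"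
  let ?E = "{w \<in> space M. ?U w = z}"
  let ?p = "\<lambda>x. measure M {w \<in> space M. ?U w = z \<and> X w = x}"
  let ?N = "distr (uniform_measure M ?E) (count_space UNIV) X"
  have "?U \<in> measurable M (count_space UNIV)"
    by (rule measurable_compose[OF S]) simp
  then have pU[measurable]: "Measurable.pred M (\<lambda>w. ?U w = z)"
    by measurable
  have E: "?E \<in> sets M" by measurable
  have pX[measurable]: "Measurable.pred M (\<lambda>w. X w = x)" for x by measurable
  have le: "?p x \<le> measure M ?E" for x by (auto intro!: M.finite_measure_mono)
  show "measure M ?E * KL_divergence b (uniform_measure (count_space UNIV) (psi_sub \<psi> Z z)) ?N
    = (\<Sum>x\<in>UNIV. ?p x * log b (?p x / measure M ?E * n))"
  proof (cases "measure M ?E = 0")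
    \<comment> \<open>For a null value \<open>z\<close> both sides are 0: on the left the weight
      vanishes, on the right every joint probability does.\<close>
    case True
    then have "?p x = 0" for x using le[of x] by (simp add: measure_le_0_iff)
    with True show ?thesis by simp
  next
    case False
    then have E0: "emeasure M ?E \<noteq> 0" by (simp add: M.emeasure_eq_measure)
    have N: "prob_space ?N"
      by (intro prob_space.prob_space_distr prob_space_uniform_measure E0) (simp_all)
    have meas: "measure ?N {x} = ?p x / measure M ?E" for x
    proof -
      have "measure ?N {x} = measure (uniform_measure M ?E) (X -` {x} \<inter> space M)"
        using X by (subst measure_distr) simp_all
      also have "\<dots> = measure M (?E \<inter> (X -` {x} \<inter> space M)) / measure M ?E"
        by (rule measure_uniform_measure[OF E0])
          (use measurable_sets[OF X, of "{x}"] in \<open>simp_all\<close>)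
      also have "?E \<inter> (X -` {x} \<inter> space M) = {w \<in> space M. ?U w = z \<and> X w = x}" by auto
      finally show ?thesis .
    qed
    have supp: "measure ?N {x} = 0" if "x \<notin> psi_sub \<psi> Z z" for x
    proof -
      have "AE w in M. \<not> (?U w = z \<and> X w = x)"
        using that by (intro eventually_mono[OF ae]) auto
      then have "?p x = 0" by (simp add: M.prob_Collect_eq_0)
      then show ?thesis by (simp add: meas)
    qed
    have "psi_sub \<psi> Z z \<noteq> {}" using card[of z] n by auto
    then have "KL_divergence b (uniform_measure (count_space UNIV) (psi_sub \<psi> Z z)) ?N
      = (\<Sum>x\<in>UNIV. ?p x / measure M ?E * log b (?p x / measure M ?E * n))"
      using KL_divergence_uniform_finite[OF b N _ _ supp] by (simp add: meas card)
    then show ?thesis using False by (simp add: sum_distrib_left)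
  qed
qed

section \<open>Counting fibres and images of linear maps\<close>

text \<open>Subtracting a fixed point of the fibre injects it into the kernel of \<open>g\<close> on
  \<open>A\<close>. Kernel times image injects into \<open>A\<close> by adding a chosen preimage.
  The assumption on \<open>g\<close> expresses additivity through level sets, which avoids adding
  the extensional values of \<open>mat_vec\<close>.\<close>

lemma card_fiber_mult_card_image_le:
  fixes A :: "'v::ab_group_add set"
  assumes fin: "finite A"
    and add: "\<And>x y. x \<in> A \<Longrightarrow> y \<in> A \<Longrightarrow> x + y \<in> A"
    and g: "\<And>x y. g x = g y \<longleftrightarrow> g (x - y) = g 0"
    and D: "\<And>x y. x \<in> D \<Longrightarrow> y \<in> D \<Longrightarrow> x - y \<in> A"
  shows "card {x \<in> D. g x = v} * card (g ` A) \<le> card A"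
proof -
  let ?F = "{x \<in> D. g x = v}" and ?T = "{t \<in> A. g t = g 0}"
  have "card ?F \<le> card ?T"
  proof (cases "?F = {}")
    case False
    then obtain x0 where x0: "x0 \<in> D" "g x0 = v" by auto
    show ?thesis
    proof (rule card_inj_on_le)
      show "inj_on (\<lambda>x. x - x0) ?F" by (auto intro: inj_onI)
      show "(\<lambda>x. x - x0) ` ?F \<subseteq> ?T"
      proof (intro image_subsetI)
        fix x assume x: "x \<in> ?F"
        then have "g (x - x0) = g 0" using x0 g[of x x0] by simp
        moreover have "x - x0 \<in> A" using x x0 D by blast
        ultimately show "x - x0 \<in> ?T" by simp
      qed
    qed (use fin in simp)
  next
    case True
    then show ?thesis by (simp only: card.empty)
  qed
  moreover have "card (?T \<times> g ` A) \<le> card A"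
  proof (rule card_inj_on_le)
    have sel: "inv_into A g w \<in> A" "g (inv_into A g w) = w" if "w \<in> g ` A" for w
      using that by (auto intro: inv_into_into f_inv_into_f)
    have shift: "g (t + a) = g a" if "g t = g 0" for t a
      using g[of "t + a" a] that by simp
    let ?h = "\<lambda>(t, w). t + inv_into A g w"
    show "inj_on ?h (?T \<times> g ` A)"
    proof (rule inj_onI; clarify)
      fix t a t' a'
      assume *: "a \<in> A" "a' \<in> A" "g t = g 0" "g t' = g 0"
        and eq: "t + inv_into A g (g a) = t' + inv_into A g (g a')"
      \<comment> \<open>Applying \<open>g\<close> removes the kernel part and recovers the image
        component; cancellation then gives the kernel component.\<close>
      have "g a = g a'"
        using arg_cong[OF eq, of g] * sel(2)[of "g a"] sel(2)[of "g a'"] by (simp add: shift)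
      with eq show "t = t' \<and> g a = g a'" by simp
    qed
    show "?h ` (?T \<times> g ` A) \<subseteq> A"
    proof (intro image_subsetI)
      fix p assume "p \<in> ?T \<times> g ` A"
      then have "fst p \<in> A" "inv_into A g (snd p) \<in> A" using sel(1) by auto
      then show "?h p \<in> A" unfolding split_beta by (rule add)
    qed
  qed (rule fin)
  ultimately show ?thesis
    unfolding card_cartesian_product by (rule order_trans[OF mult_le_mono1])
qed

lemma mat_vec_eq_iff:
  "mat_vec k B x = mat_vec k B y
    \<longleftrightarrow> (\<forall>i<k. (\<Sum>j\<in>UNIV. B i $ j * x $ j) = (\<Sum>j\<in>UNIV. B i $ j * y $ j))"
  unfolding mat_vec_def by (metis (mono_tags, lifting) lessThan_iff restrict_apply' restrict_ext)

lemma mat_vec_eq_iff_diff: "mat_vec k B x = mat_vec k B y \<longleftrightarrow> mat_vec k B (x - y) = mat_vec k B 0"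
  unfolding mat_vec_eq_iff by (simp add: right_diff_distrib sum_subtractf)

text \<open>A value on \<open>D\<close> is glued from the first \<open>k\<close> entries of a value
  on \<open>A\<close> and at most \<open>\<mu> - k\<close> free entries. When \<open>k\<close>
  exceeds \<open>\<mu>\<close>, \<open>min\<close> restricts the comparison to existing rows and
  truncated subtraction makes the factor 1.\<close>

lemma card_mat_vec_image_le:
  fixes A D :: "('a::{field,finite} ^ 'n) set"
  assumes "\<And>x. x \<in> D \<Longrightarrow> \<exists>a\<in>A. \<forall>i<min k \<mu>.
    (\<Sum>j\<in>UNIV. B i $ j * x $ j) = (\<Sum>j\<in>UNIV. B i $ j * a $ j)"
  shows "card (mat_vec \<mu> B ` D) \<le> card (mat_vec \<mu> B ` A) * CARD('a) ^ (\<mu> - k)"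
proof -
  let ?h = "\<lambda>(w, e). \<lambda>i\<in>{..<\<mu>}. if i < k then w i else e i"
  let ?P = "mat_vec \<mu> B ` A \<times> ({k..<\<mu>} \<rightarrow>\<^sub>E (UNIV :: 'a set))"
  have fin: "finite ?P" by (intro finite_cartesian_product finite_PiE finite_imageI) auto
  have "mat_vec \<mu> B ` D \<subseteq> ?h ` ?P"
  proof
    fix w assume "w \<in> mat_vec \<mu> B ` D"
    then obtain x where x: "x \<in> D" "w = mat_vec \<mu> B x" by auto
    obtain a where a: "a \<in> A"
      "\<And>i. i < min k \<mu> \<Longrightarrow> (\<Sum>j\<in>UNIV. B i $ j * x $ j) = (\<Sum>j\<in>UNIV. B i $ j * a $ j)"
      using assms[OF x(1)] by auto
    have "w = ?h (mat_vec \<mu> B a, restrict w {k..<\<mu>})"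
      by (auto simp: x mat_vec_def restrict_def fun_eq_iff a(2))
    moreover have "(mat_vec \<mu> B a, restrict w {k..<\<mu>}) \<in> ?P"
      using a(1) by auto
    ultimately show "w \<in> ?h ` ?P" by (rule image_eqI)
  qed
  then have "card (mat_vec \<mu> B ` D) \<le> card ?P"
    using fin by (rule surj_card_le[rotated])
  also have "\<dots> = card (mat_vec \<mu> B ` A) * CARD('a) ^ (\<mu> - k)"
    by (simp add: card_cartesian_product card_PiE)
  finally show ?thesis .
qed

section \<open>Cosets of the scheme and its universal strength\<close>

context
  fixes \<psi> :: "'a::{field,finite} ^ 'l \<Rightarrow> ('a ^ 'n) set" and C1 C2 :: "('a ^ 'n) set"
  assumes C2: "vec.subspace C2" and psi: "linear_bij_to_quotient \<psi> C1 C2"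
begin

lemma psi_nonempty: "\<psi> s \<noteq> {}"
proof -
  have "\<psi> s \<in> quotient_space C1 C2"
    using psi by (auto simp: linear_bij_to_quotient_def bij_betw_def)
  moreover have "C2 \<noteq> {}" using vec.subspace_0[OF C2] by auto
  ultimately show ?thesis by (auto simp: quotient_space_def)
qed

lemma psi_add: "x \<in> \<psi> s \<Longrightarrow> y \<in> \<psi> t \<Longrightarrow> x + y \<in> \<psi> (s + t)"
  using psi by (auto simp: linear_bij_to_quotient_def coset_add_def)

lemma psi_diff:
  assumes "x \<in> \<psi> s" "y \<in> \<psi> t"
  shows "x - y \<in> \<psi> (s - t)"
proof -
  \<comment> \<open>\<open>coset_scale\<close> asks for a summand from \<open>C2\<close>, here
    0.\<close>
  have "(- 1) *s y + 0 \<in> \<psi> ((- 1) *s t)"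
    using psi assms(2) vec.subspace_0[OF C2]
    unfolding linear_bij_to_quotient_def coset_scale_def by blast
  then have "- y \<in> \<psi> (- t)" by simp
  from psi_add[OF assms(1) this] show ?thesis by simp
qed

lemma psi_0: "\<psi> 0 = C2"
proof -
  \<comment> \<open>Scaling by 0 collapses the nonempty coset to the origin, so only the added
    \<open>C2\<close> remains.\<close>
  have "\<psi> (0 *s 0) = coset_scale C2 0 (\<psi> 0)"
    using psi by (simp only: linear_bij_to_quotient_def)
  also have "\<dots> = C2" using psi_nonempty[of 0] by (auto simp: coset_scale_def)
  finally show ?thesis by simp
qed

lemma psi_cover: "x \<in> C1 \<Longrightarrow> \<exists>s. x \<in> \<psi> s"
proof -
  assume "x \<in> C1"
  then have "(+) x ` C2 \<in> range \<psi>"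
    using psi by (auto simp: linear_bij_to_quotient_def bij_betw_def quotient_space_def)
  then obtain s where "(+) x ` C2 = \<psi> s" by auto
  moreover have "x + 0 \<in> (+) x ` C2" using vec.subspace_0[OF C2] by blast
  ultimately show ?thesis by auto
qed

lemma psi_subset:
  assumes "vec.subspace C1" "C2 \<subseteq> C1"
  shows "\<psi> s \<subseteq> C1"
proof -
  have "\<psi> s \<in> quotient_space C1 C2"
    using psi by (auto simp: linear_bij_to_quotient_def bij_betw_def)
  then show ?thesis using assms by (auto simp: quotient_space_def intro!: vec.subspace_add[OF assms(1)])
qed

lemma psi_sub_nonempty: "psi_sub \<psi> Z z \<noteq> {}"
proof -
  have "\<psi> (\<chi> i. z i) \<subseteq> psi_sub \<psi> Z z" by (auto simp: psi_sub_def intro!: exI[of _ "\<chi> i. z i"])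
  then show ?thesis using psi_nonempty by blast
qed

text \<open>Together with \<open>psi_sub_diff\<close>, this makes
  \<open>psi_sub \<psi> Z (\<lambda>_. 0)\<close> a subgroup and every
  \<open>psi_sub \<psi> Z z\<close> a coset of it. The constant family can stand for the zero value
  because \<open>psi_sub\<close> reads its argument only on \<open>Z\<close>.\<close>

lemma psi_sub_add:
  assumes "x \<in> psi_sub \<psi> Z z" "y \<in> psi_sub \<psi> Z (\<lambda>_. 0)"
  shows "x + y \<in> psi_sub \<psi> Z z"
proof -
  obtain s t where "x \<in> \<psi> s" "\<forall>i\<in>Z. s $ i = z i" "y \<in> \<psi> t" "\<forall>i\<in>Z. t $ i = 0"
    using assms unfolding psi_sub_def by blast
  then have "x + y \<in> \<psi> (s + t)" "\<forall>i\<in>Z. (s + t) $ i = z i"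
    using psi_add by simp_all
  then show ?thesis unfolding psi_sub_def by blast
qed

lemma psi_sub_diff:
  assumes "x \<in> psi_sub \<psi> Z z" "y \<in> psi_sub \<psi> Z z"
  shows "x - y \<in> psi_sub \<psi> Z (\<lambda>_. 0)"
proof -
  obtain s t where "x \<in> \<psi> s" "\<forall>i\<in>Z. s $ i = z i" "y \<in> \<psi> t" "\<forall>i\<in>Z. t $ i = z i"
    using assms unfolding psi_sub_def by blast
  then have "x - y \<in> \<psi> (s - t)" "\<forall>i\<in>Z. (s - t) $ i = 0"
    using psi_diff by simp_all
  then show ?thesis unfolding psi_sub_def by blast
qed

lemma card_psi_sub: "card (psi_sub \<psi> Z z) = card (psi_sub \<psi> Z (\<lambda>_. 0))"
proof -
  obtain x0 where x0: "x0 \<in> psi_sub \<psi> Z z" using psi_sub_nonempty by blast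
  have "psi_sub \<psi> Z z = (+) x0 ` psi_sub \<psi> Z (\<lambda>_. 0)"
  proof (intro equalityI subsetI)
    fix x assume "x \<in> psi_sub \<psi> Z z"
    then have "x - x0 \<in> psi_sub \<psi> Z (\<lambda>_. 0)" using x0 by (rule psi_sub_diff)
    then have "x0 + (x - x0) \<in> (+) x0 ` psi_sub \<psi> Z (\<lambda>_. 0)" by (rule imageI)
    then show "x \<in> (+) x0 ` psi_sub \<psi> Z (\<lambda>_. 0)" by simp
  qed (use psi_sub_add[OF x0] in auto)
  then show ?thesis by (simp add: card_image)
qed

text \<open>The strength enters the proof only through which pairs are possible, so the support is
  all that is needed of this distribution.\<close>

lemma set_pmf_uniform_scheme: "set_pmf (uniform_scheme \<psi>) = {(s, x). x \<in> \<psi> s}"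
  unfolding uniform_scheme_def using psi_nonempty by (auto simp: set_pmf_of_set)

text \<open>Zero information makes a vanishing secret part on \<open>Z\<close> compatible with the
  rows that \<open>x\<close> produces; a point of the support realising both supplies
  \<open>a\<close>. The strength speaks of matrices with one exact number of rows, while
  \<open>\<mu>\<close> is arbitrary, hence the \<open>min\<close>.\<close>

lemma universal_strength_witness:
  assumes b: "1 < b" and strength: "has_universal_strength b K \<psi> \<omega>" and K: "0 \<in> K"
    and B: "B \<in> matrices_over K \<mu>" and x: "x \<in> C1"
  shows "\<exists>a\<in>psi_sub \<psi> Z (\<lambda>_. 0). \<forall>i<min (nat (\<omega> - int (card Z) + 1)) \<mu>.
    (\<Sum>j\<in>UNIV. B i $ j * x $ j) = (\<Sum>j\<in>UNIV. B i $ j * a $ j)"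
proof (cases "\<omega> - int (card Z) + 1 \<le> 0")
  \<comment> \<open>The strength says nothing about this \<open>Z\<close>, but \<open>nat\<close> is
    0 and no row is compared, so any element serves.\<close>
  case True
  obtain a where "a \<in> psi_sub \<psi> Z (\<lambda>_. 0)" using psi_sub_nonempty by blast
  then show ?thesis using True by (intro bexI[of _ a]) simp_all
next
  case False
  define k where "k = nat (\<omega> - int (card Z) + 1)"
  \<comment> \<open>pads \<open>B\<close> with zero rows or truncates it, to exactly \<open>k\<close> rows\<close>
  define B' where "B' = (\<lambda>i\<in>{..<k}. if i < \<mu> then B i else 0)"
  let ?p = "uniform_scheme \<psi>"
  let ?U = "\<lambda>(s, x :: 'a ^ 'n). subvec Z (s :: 'a ^ 'l)"
  let ?V = "\<lambda>(s :: 'a ^ 'l, x). mat_vec k B' x"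
  interpret information_space "measure_pmf ?p" b
    by unfold_locales (rule b)
  have "B' \<in> matrices_over K k"
    using B K by (auto simp: matrices_over_def B'_def PiE_iff)
  moreover have "int k = \<omega> - int (card Z) + 1 \<and> 0 < k" using False by (auto simp: k_def)
  ultimately have info: "mutual_info b (measure_pmf ?p) ?U ?V = 0"
    using strength unfolding has_universal_strength_def by blast
  \<comment> \<open>The support points \<open>(t, x)\<close> and \<open>(0, y)\<close> give positive
    probability to the rows of \<open>x\<close> and to the zero secret part, respectively.\<close>
  obtain t where t: "x \<in> \<psi> t" using psi_cover[OF x] by auto
  obtain y where y: "y \<in> \<psi> 0" using psi_nonempty[of 0] by auto
  have "0 < measure ?p {w \<in> space ?p. ?U w = subvec Z 0 \<and> ?V w = mat_vec k B' x}"
  proof (rule prob_pair_pos_if_mutual_information_eq_0[OF _ _ _ _ info])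
    show "?U \<in> measurable ?p (count_space (Z \<rightarrow>\<^sub>E UNIV))"
      by (auto simp: subvec_def)
    show "?V \<in> measurable ?p (count_space ({..<k} \<rightarrow>\<^sub>E UNIV))"
      by (auto simp: mat_vec_def split: if_splits)
    show "0 < measure ?p {w \<in> space ?p. ?U w = subvec Z 0}"
      using y by (intro measure_pmf_posI[of "(0, y)"]) (auto simp: set_pmf_uniform_scheme)
    show "0 < measure ?p {w \<in> space ?p. ?V w = mat_vec k B' x}"
      using t by (intro measure_pmf_posI[of "(t, x)"]) (auto simp: set_pmf_uniform_scheme)
  qed (simp_all add: finite_PiE)
  then have "set_pmf ?p \<inter> {w \<in> space ?p. ?U w = subvec Z 0 \<and> ?V w = mat_vec k B' x} \<noteq> {}"
    by (simp only: measure_pmf_zero_iff[symmetric] zero_less_measure_iff not_False_eq_True)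
  then obtain s a where a: "a \<in> \<psi> s" "subvec Z s = subvec Z 0" "mat_vec k B' a = mat_vec k B' x"
    by (auto simp: set_pmf_uniform_scheme)
  have "s $ i = 0" if "i \<in> Z" for i
    using fun_cong[OF a(2), of i] that by (simp add: subvec_def)
  then have "a \<in> psi_sub \<psi> Z (\<lambda>_. 0)" using a(1) by (auto simp: psi_sub_def)
  moreover have "(\<Sum>j\<in>UNIV. B i $ j * x $ j) = (\<Sum>j\<in>UNIV. B i $ j * a $ j)" if "i < min k \<mu>" for i
  proof -
    have "B' i = B i" "i < k" using that by (simp_all add: B'_def k_def)
    with a(3) show ?thesis unfolding mat_vec_eq_iff by metis
  qed
  ultimately show ?thesis unfolding k_def by blast
qed

lemma universal_strength_bound:
  assumes b: "1 < b" and strength: "has_universal_strength b K \<psi> \<omega>" and K: "0 \<in> K" "1 \<in> K"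
    and proper: "C2 \<subset> C1"
  shows "\<omega> < int (CARD('n) + CARD('l))"
proof (rule ccontr)
  assume "\<not> ?thesis"
  then have k: "CARD('n) \<le> nat (\<omega> - int (card (UNIV :: 'l set)) + 1)" by simp
  \<comment> \<open>With at least \<open>n\<close> rows available, \<open>B\<close> can be the identity matrix, which forces \<open>C1 = C2\<close>.\<close>
  obtain h :: "nat \<Rightarrow> 'n" where h: "bij_betw h {..<CARD('n)} UNIV"
    using ex_bij_betw_nat_finite[of "UNIV :: 'n set"] by (auto simp: lessThan_atLeast0)
  define B :: "nat \<Rightarrow> 'a ^ 'n" where "B = (\<lambda>i\<in>{..<CARD('n)}. axis (h i) 1)"
  have B: "B \<in> matrices_over K (CARD('n))"
    using K by (auto simp: matrices_over_def B_def axis_def)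
  have row: "(\<Sum>j\<in>UNIV. B i $ j * x $ j) = x $ h i" if "i < CARD('n)" for i x
    using that by (simp add: B_def axis_def if_distrib[of "\<lambda>c. c * _"] cong: if_cong)
  have "x \<in> C2" if x: "x \<in> C1" for x
  proof -
    obtain a where a: "a \<in> psi_sub \<psi> UNIV (\<lambda>_. 0)" "\<And>i. i < CARD('n) \<Longrightarrow> x $ h i = a $ h i"
      using universal_strength_witness[OF b strength K(1) B x, of UNIV] k row by fastforce
    \<comment> \<open>Taking all coordinates as \<open>Z\<close> fixes the whole secret to 0, which
      leaves only \<open>\<psi> 0 = C2\<close>.\<close>
    have "{s :: 'a ^ 'l. \<forall>i\<in>UNIV. s $ i = 0} = {0}" by (auto simp: vec_eq_iff)
    then have "a \<in> C2" using a(1) by (simp add: psi_sub_def psi_0)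
    moreover have "x = a"
      unfolding vec_eq_iff
    proof
      fix j
      have "j \<in> h ` {..<CARD('n)}" using h by (simp add: bij_betw_def)
      then show "x $ j = a $ j" using a(2) by auto
    qed
    ultimately show ?thesis by simp
  qed
  then show False using proper by blast
qed

lemma has_universal_strength_max:
  assumes "1 < b" "0 \<in> K" "1 \<in> K" "C2 \<subset> C1"
  shows "has_universal_strength b K \<psi> (universal_max_strength b K \<psi>)"
proof -
  \<comment> \<open>The strength \<open>- 1\<close> holds vacuously, so the maximum exists because strengths are bounded.\<close>
  let ?H = "has_universal_strength b K \<psi>"
  let ?F = "{\<omega>. ?H \<omega> \<and> - 1 \<le> \<omega>}"
  have "?F \<subseteq> {- 1..<int (CARD('n) + CARD('l))}"
    using universal_strength_bound[OF assms(1) _ assms(2-4)] by auto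
  then have fin: "finite ?F" by (rule finite_subset) simp
  have "?H (- 1)" by (simp add: has_universal_strength_def)
  then have ne: "- 1 \<in> ?F" by simp
  have "?H (Max ?F)" using Max_in[OF fin] ne by blast
  moreover have "\<omega> \<le> Max ?F" if "?H \<omega>" for \<omega>
  proof (cases "- 1 \<le> \<omega>")
    case True
    then show ?thesis using fin that by (intro Max_ge) auto
  next
    \<comment> \<open>Strengths under \<open>- 1\<close> were cut off to keep \<open>?F\<close>
      finite; they are below its maximum anyway.\<close>
    case False
    then show ?thesis using Max_ge[OF fin ne] by linarith
  qed
  ultimately have "universal_max_strength b K \<psi> = Max ?F"
    unfolding universal_max_strength_def by (intro Greatest_equality)
  then show ?thesis using \<open>?H (Max ?F)\<close> by simp
qed

end

section \<open>Assembly of the bound\<close>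

theorem corollary30:
  fixes K :: "'a::{field,finite} set"
    and q m :: nat
    and C1 C2 :: "('a ^ 'n) set"
    and \<psi> :: "'a ^ 'l \<Rightarrow> ('a ^ 'n) set"
    and M :: "'w measure"
    and S :: "'w \<Rightarrow> 'a ^ 'l"
    and X :: "'w \<Rightarrow> 'a ^ 'n"
    and Z :: "'l set"
    and \<mu> :: nat
  assumes "is_subfield K" and "card K = q" and "m \<ge> 1" and "CARD('a) = q ^ m"
    and "vec.subspace C1" and "vec.subspace C2" and "C2 \<subset> C1"
    and "vec.dim C1 = vec.dim C2 + CARD('l)"
    and "linear_bij_to_quotient \<psi> C1 C2"
    and "prob_space M"
    and "S \<in> measurable M (count_space UNIV)"
    and "X \<in> measurable M (count_space UNIV)"
    and "AE w in M. X w \<in> \<psi> (S w)"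
    and "\<mu> \<le> CARD('n)"
    and "Z \<noteq> {}"
  shows "(MAX B\<in>matrices_over K \<mu>.
            mutual_info (real (q ^ m)) M (\<lambda>w. subvec Z (S w)) (\<lambda>w. mat_vec \<mu> B (X w)))
         \<le> real_of_int (max 0 (int \<mu> - universal_max_strength (real (q ^ m)) K \<psi> + int (card Z) - 1))
           + cond_divergence_uniform (real (q ^ m)) \<psi> Z M S X"
proof -
  define b where "b = real (q ^ m)"
  define \<Omega> where "\<Omega> = universal_max_strength b K \<psi>"
  have K: "0 \<in> K" "1 \<in> K" using assms(1) by (auto simp: is_subfield_def)
  have bN: "b = real CARD('a)" using assms(4) by (simp add: b_def)
  \<comment> \<open>The distinct elements 0 and 1 force the base of the logarithm above 1.\<close>
  have "card {0, 1 :: 'a} \<le> CARD('a)" by (rule card_mono) auto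
  then have b1: "1 < b" by (simp add: bN)
  interpret information_space M b
    using assms(10) b1 by (simp add: information_space_def information_space_axioms_def)
  note scheme = assms(6,9)
  let ?A = "psi_sub \<psi> Z (\<lambda>_. 0)" and ?U = "\<lambda>w. subvec Z (S w)"
  have n: "0 < card ?A" using psi_sub_nonempty[OF scheme] by (simp add: card_gt_0_iff)
  have ae: "AE w in M. X w \<in> psi_sub \<psi> Z (?U w)"
    using assms(13) by (rule eventually_mono) (auto simp: psi_sub_def subvec_def)
  have U: "?U \<in> measurable M (count_space (Z \<rightarrow>\<^sub>E UNIV))"
    by (rule measurable_compose[OF assms(11)]) (auto simp: subvec_def)
  have strength: "has_universal_strength b K \<psi> \<Omega>"
    unfolding \<Omega>_def using has_universal_strength_max[OF scheme b1 K assms(7)] .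
  have main: "mutual_info b M ?U (\<lambda>w. mat_vec \<mu> B (X w))
    \<le> real_of_int (max 0 (int \<mu> - \<Omega> + int (card Z) - 1)) + cond_divergence_uniform b \<psi> Z M S X"
    if B: "B \<in> matrices_over K \<mu>" for B
  proof -
    let ?g = "mat_vec \<mu> B" and ?k = "nat (\<Omega> - int (card Z) + 1)"
    have k: "0 < card (?g ` ?A)" using psi_sub_nonempty[OF scheme] by (simp add: card_gt_0_iff)
    have "C1 \<noteq> {}" using assms(7) by blast
    then have W: "0 < card (?g ` C1)" by (simp add: card_gt_0_iff)
    \<comment> \<open>The general bound is used with \<open>n\<close> the size of \<open>?A\<close>,
      \<open>k\<close> the size of its image under \<open>?g\<close>, and \<open>W\<close> the image
      of \<open>C1\<close>.\<close>
    have "mutual_info b M ?U (\<lambda>w. ?g (X w)) \<le> log b (card (?g ` C1) / card (?g ` ?A))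
      + cond_divergence_uniform b \<psi> Z M S X"
      unfolding cond_divergence_uniform_eq[OF assms(10) b1 assms(11,12) ae card_psi_sub[OF scheme] n]
    proof (rule mutual_information_function_le[where A="psi_sub \<psi> Z" and U="?U", OF _ U assms(12) ae n k])
      show "card {x \<in> psi_sub \<psi> Z z. ?g x = y} * card (?g ` ?A) \<le> card ?A" for z y
        by (rule card_fiber_mult_card_image_le;
          (rule mat_vec_eq_iff_diff | auto intro: psi_sub_add[OF scheme] psi_sub_diff[OF scheme]))
      show "?g x \<in> ?g ` C1" if "x \<in> psi_sub \<psi> Z z" for x z
        using that psi_subset[OF scheme assms(5)] assms(7) by (auto simp: psi_sub_def)
    qed (auto intro: finite_PiE)
    moreover have "log b (card (?g ` C1) / card (?g ` ?A)) \<le> real (\<mu> - ?k)"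
    proof -
      have "card (?g ` C1) \<le> card (?g ` ?A) * CARD('a) ^ (\<mu> - ?k)"
        by (rule card_mat_vec_image_le)
          (rule universal_strength_witness[OF scheme b1 strength K(1) B])
      then have "real (card (?g ` C1)) \<le> real (card (?g ` ?A) * CARD('a) ^ (\<mu> - ?k))"
        by (simp only: of_nat_le_iff)
      then have "card (?g ` C1) / card (?g ` ?A) \<le> b ^ (\<mu> - ?k)"
        using k by (simp add: bN pos_divide_le_eq mult.commute)
      then have "log b (card (?g ` C1) / card (?g ` ?A)) \<le> log b (b ^ (\<mu> - ?k))"
        using b1 k W by (intro log_mono) auto
      then show ?thesis using b1 by (simp add: log_nat_power)
    qed
    \<comment> \<open>Truncated subtraction accounts for the positive part. If
      \<open>\<Omega> - int (card Z) + 1\<close> is negative, then \<open>?k = 0\<close> and the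
      right side exceeds \<open>\<mu>\<close>, so only an inequality holds.\<close>
    moreover have "real (\<mu> - ?k) \<le> real_of_int (max 0 (int \<mu> - \<Omega> + int (card Z) - 1))"
      by linarith
    ultimately show ?thesis by linarith
  qed
  have fin: "finite (matrices_over K \<mu> :: (nat \<Rightarrow> 'a ^ 'n) set)"
    unfolding matrices_over_def by (intro finite_PiE) auto
  \<comment> \<open>The zero matrix shows that the maximum ranges over a nonempty set, as
    \<open>Max_le_iff\<close> requires.\<close>
  have "(\<lambda>i\<in>{..<\<mu>}. 0) \<in> (matrices_over K \<mu> :: (nat \<Rightarrow> 'a ^ 'n) set)"
    using K by (auto simp: matrices_over_def)
  then have "matrices_over K \<mu> \<noteq> ({} :: (nat \<Rightarrow> 'a ^ 'n) set)" by blast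
  then show ?thesis
    unfolding b_def[symmetric] \<Omega>_def[symmetric]
    using fin main by (subst Max_le_iff) auto
qed

end
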